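(* Let $t$ be an odd positive integer and let $r$ be a positive integer. If $r$ is even or $r\geq (t+1)(t+2)$, then there is an $r$-regular graph that has no $\{t,r-t\}$-factor.
   Context: Graphs are finite, simple and undirected, with a nonempty vertex set. A $\{t,r-t\}$-factor of a graph $G$ is a spanning subgraph of $G$ in which every vertex has degree either $t$ or $r-t$. *)

theory Defs
  imports "Graph_Theory.Graph_Theory"
begin

text \<open>
  A finite simple undirected graph is a finite symmetric loop-free digraph whose arcs are pairs of
  vertices (\<^locale>\<open>pair_graph\<close>): each edge \<open>uv\<close> is represented by the two arcs
  \<open>(u, v)\<close> and \<open>(v, u)\<close>. The library admits the null graph, so nonemptiness is required
  separately.
\<close>

definition simple_graph :: "'a pair_pre_digraph \<Rightarrow> bool" where
  "simple_graph G \<longleftrightarrow> pair_graph G \<and> pverts G \<noteq> {}"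

text \<open>
  Every edge at \<open>v\<close> contributes exactly one arc leaving \<open>v\<close>, so the degree is the out-degree.
\<close>

definition vdegree :: "'a pair_pre_digraph \<Rightarrow> 'a \<Rightarrow> nat" where
  "vdegree G v = out_degree (with_proj G) v"

lemma vdegree_eq_card_neighbours: "vdegree G v = card {w. (v, w) \<in> parcs G}"
proof -
  have "out_arcs (with_proj G) v = Pair v ` {w. (v, w) \<in> parcs G}"
    by (auto simp: out_arcs_def)
  then show ?thesis
    by (simp add: vdegree_def out_degree_def card_image inj_on_def)
qed

definition regular_graph :: "nat \<Rightarrow> 'a pair_pre_digraph \<Rightarrow> bool" where
  "regular_graph r G \<longleftrightarrow> simple_graph G \<and> (\<forall>v\<in>pverts G. vdegree G v = r)"

text \<open>
  \<open>F\<close> must itself be an undirected graph: \<^const>\<open>spanning\<close> alone would also allow subdigraphs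
  that contain only one of the two arcs of an edge. The prescribed degrees \<open>D\<close> are integers, so that
  \<open>r - t\<close> is not truncated to the admissible degree 0 when \<open>r < t\<close>.
\<close>

definition is_factor :: "int set \<Rightarrow> 'a pair_pre_digraph \<Rightarrow> 'a pair_pre_digraph \<Rightarrow> bool" where
  "is_factor D G F \<longleftrightarrow>
     simple_graph F \<and> spanning (with_proj F) (with_proj G) \<and>
     (\<forall>v\<in>pverts F. int (vdegree F v) \<in> D)"

end

theory Submission
  imports Defs
begin

text \<open>
  For even \<open>r\<close> all degrees in a \<open>{t, r - t}\<close>-factor are odd, so the complete graph on the odd
  number \<open>r + 1\<close> of vertices has no such factor, by the handshake lemma.

  For odd \<open>r\<close> the graph consists of a single vertex, the hub, and \<open>t + 2\<close> gadgets that meet only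
  through it. Call the edges of a putative factor red and the other edges blue; every vertex has
  \<open>t\<close> or \<open>r - t\<close> red edges. If at least \<open>t + 1\<close> of the gadgets have the property that the edges
  joining them to the hub cannot be all blue and cannot be all red, then the hub has at least
  \<open>t + 1\<close> red and at least \<open>t + 1\<close> blue edges, which is a contradiction.

  A gadget with this property is \<open>K\<^bsub>r,r-1\<^esub>\<close>, with independent sides \<open>Y\<close> of size \<open>r\<close> and \<open>T\<close>
  of size \<open>r - 1\<close>. The vertices of \<open>Y\<close> still miss one edge each: \<open>k\<close> of them are joined to the
  hub, where \<open>k\<close> is odd and exceeds \<open>t\<close>, and the other \<open>r - k\<close> are matched among themselves. Let
  \<open>n\<close> be the number of red hub edges of the gadget and \<open>m\<close> twice the number of its red matching
  edges. Counting the red edges between \<open>Y\<close> and \<open>T\<close> from both sides gives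
  \<open>m + n = t + (r - 2t) s\<close>, where \<open>s\<close> is the number of vertices of red degree \<open>r - t\<close> in \<open>Y\<close>
  minus that in \<open>T\<close>. Since \<open>m\<close> is even and \<open>0 \<le> m \<le> r - k\<close>, both \<open>n = 0\<close> and \<open>n = k\<close> are
  impossible (\<open>gadget_not_monochromatic\<close>).

  The smallest odd \<open>k\<close> above \<open>t\<close> is \<open>t + 2\<close>, so \<open>t + 1\<close> gadgets use \<open>(t + 1)(t + 2)\<close> edges at the
  hub. The remaining \<open>r - (t + 1)(t + 2)\<close> edges, an odd number, go to one further gadget.
\<close>

section \<open>Factors as symmetric relations\<close>

text \<open>
  Both the graph and its spanning subgraphs are determined by their symmetric arc relations, and a
  finite vertex set of any type can be renamed injectively by natural numbers. This allows the
  constructions to use whatever vertex type suits them, and the nonexistence arguments to speak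
  of relations only.
\<close>

lemma regular_graph_without_factor:
  fixes V :: "'a set" and E :: "'a rel"
  assumes "finite V" "V \<noteq> {}" "E \<subseteq> V \<times> V" "sym E" "irrefl E"
    and deg: "\<And>v. v \<in> V \<Longrightarrow> card (E `` {v}) = r"
    and nofactor: "\<And>R. R \<subseteq> E \<Longrightarrow> sym R \<Longrightarrow> \<forall>v\<in>V. int (card (R `` {v})) \<in> D \<Longrightarrow> False"
  shows "\<exists>G :: nat pair_pre_digraph. regular_graph r G \<and> \<not> (\<exists>F. is_factor D G F)"
proof -
  obtain f :: "'a \<Rightarrow> nat" where f: "inj_on f V"
    using \<open>finite V\<close> finite_imp_inj_to_nat_seg by metis
  define G :: "nat pair_pre_digraph"
    where "G = \<lparr> pverts = f ` V, parcs = map_prod f f ` E \<rparr>"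
  have "finite E"
    using assms by (meson finite_SigmaI finite_subset)
  have E_V: "u \<in> V" "v \<in> V" if "(u, v) \<in> E" for u v
    using that \<open>E \<subseteq> V \<times> V\<close> by auto
  have "pair_graph G"
  proof
    show "finite (pverts G)" "finite (parcs G)"
      using \<open>finite V\<close> \<open>finite E\<close> by (simp_all add: G_def)
    show "fst e \<in> pverts G" "snd e \<in> pverts G" if "e \<in> parcs G" for e
      using that E_V by (auto simp: G_def)
    show "fst e \<noteq> snd e" if "e \<in> parcs G" for e
      using that E_V f \<open>irrefl E\<close> by (fastforce simp: G_def irrefl_def dest: inj_onD)
    show "symmetric (with_proj G)"
      using \<open>sym E\<close> by (force simp: symmetric_def G_def arcs_ends_conv sym_def intro!: symI)
  qed
  moreover have "vdegree G (f v) = r" if "v \<in> V" for v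
  proof -
    have "{w. (f v, w) \<in> parcs G} = f ` (E `` {v})"
    proof (intro equalityI subsetI)
      fix w assume "w \<in> {w. (f v, w) \<in> parcs G}"
      then obtain x y where "(x, y) \<in> E" "f v = f x" "w = f y"
        by (auto simp: G_def)
      moreover from this have "v = x"
        using f that E_V by (auto dest: inj_onD)
      ultimately show "w \<in> f ` (E `` {v})" by auto
    qed (auto simp: G_def)
    moreover have "inj_on f (E `` {v})"
      using f by (rule inj_on_subset) (use E_V in auto)
    ultimately show ?thesis
      using deg[OF that] by (simp add: vdegree_eq_card_neighbours card_image)
  qed
  ultimately have "regular_graph r G"
    using \<open>V \<noteq> {}\<close> by (auto simp: regular_graph_def simple_graph_def G_def)
  moreover have False if "is_factor D G F" for F
  proof -
    have verts: "pverts F = f ` V" and arcs: "parcs F \<subseteq> map_prod f f ` E"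
      and "pair_graph F" and degF: "\<forall>v\<in>pverts F. int (vdegree F v) \<in> D"
      using that by (auto simp: is_factor_def simple_graph_def spanning_def subgraph_def G_def)
    define R where "R = {(u, v). u \<in> V \<and> v \<in> V \<and> (f u, f v) \<in> parcs F}"
    have symF: "(v, u) \<in> parcs F" if "(u, v) \<in> parcs F" for u v
    proof -
      interpret F: pair_graph F by fact
      have "symmetric (with_proj F)"
        by (rule F.sym_arcs)
      with that show ?thesis
        by (auto simp: symmetric_def arcs_ends_conv dest: symD)
    qed
    have "R \<subseteq> E"
    proof clarify
      fix u v assume "(u, v) \<in> R"
      then have uv: "u \<in> V" "v \<in> V" and "(f u, f v) \<in> map_prod f f ` E"
        using arcs by (auto simp: R_def)
      then obtain x y where xy: "(x, y) \<in> E" "f u = f x" "f v = f y"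
        by auto
      with uv E_V f have "u = x" "v = y"
        by (auto dest: inj_onD)
      with xy show "(u, v) \<in> E" by simp
    qed
    moreover have "sym R"
      using symF by (auto simp: R_def sym_def)
    moreover have "int (card (R `` {v})) \<in> D" if "v \<in> V" for v
    proof -
      have "{w. (f v, w) \<in> parcs F} = f ` (R `` {v})"
        using that arcs E_V by (force simp: R_def)
      moreover have "inj_on f (R `` {v})"
        using f by (rule inj_on_subset) (auto simp: R_def)
      ultimately have "vdegree F (f v) = card (R `` {v})"
        by (simp add: vdegree_eq_card_neighbours card_image)
      with degF that verts show ?thesis by (metis imageI)
    qed
    ultimately show False
      using nofactor by blast
  qed
  ultimately show ?thesis by blast
qed

section \<open>Counting arcs\<close>

lemma card_Int_Times:
  assumes "finite A" "finite B"
  shows "card (R \<inter> A \<times> B) = (\<Sum>a\<in>A. card (R `` {a} \<inter> B))"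
proof -
  have "R \<inter> A \<times> B = (SIGMA a:A. R `` {a} \<inter> B)" by auto
  then show ?thesis using assms by simp
qed

lemma card_Int_Times_sym:
  assumes "sym R"
  shows "card (R \<inter> A \<times> B) = card (R \<inter> B \<times> A)"
proof -
  have "(R \<inter> A \<times> B)\<inverse> = R \<inter> B \<times> A"
    using assms unfolding sym_def by blast
  then show ?thesis by (metis card_inverse)
qed

text \<open>
  The handshake lemma: the arcs of a symmetric loop-free relation come in pairs of opposite arcs.
\<close>

lemma even_card_sym_irrefl:
  fixes R :: "'a rel"
  assumes "finite R" "sym R" "irrefl R"
  shows "even (card R)"
proof -
  let ?P = "(\<lambda>(u, v). {(u, v), (v, u)}) ` R"
  have "card (\<Union>?P) = (\<Sum>p\<in>?P. card p)"
    by (rule card_Union_disjoint) (auto simp: pairwise_def disjnt_def)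
  also have "\<dots> = (\<Sum>p\<in>?P. 2)"
  proof (rule sum.cong)
    fix p assume "p \<in> ?P"
    then obtain u v where "(u, v) \<in> R" "p = {(u, v), (v, u)}" by auto
    then show "card p = 2"
      using \<open>irrefl R\<close> by (cases "u = v") (auto simp: irrefl_def)
  qed simp
  finally have "even (card (\<Union>?P))" by simp
  moreover have "\<Union>?P = R"
    using \<open>sym R\<close> unfolding sym_def by blast
  ultimately show ?thesis by simp
qed

lemma sum_two_valued:
  fixes d :: "'a \<Rightarrow> int"
  assumes "finite A" "\<And>x. x \<in> A \<Longrightarrow> d x \<in> {t, r - t}"
  shows "(\<Sum>x\<in>A. d x) = t * int (card A) + (r - 2 * t) * int (card {x \<in> A. d x \<noteq> t})"
proof -
  have "(\<Sum>x\<in>A. d x) = (\<Sum>x\<in>A. t + (r - 2 * t) * (if d x \<noteq> t then 1 else 0))"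
    using assms(2) by (intro sum.cong) auto
  also have "\<dots> = t * int (card A) + (r - 2 * t) * int (card {x \<in> A. d x \<noteq> t})"
    using assms(1)
    by (simp add: sum.distrib sum_distrib_left[symmetric] sum.inter_filter[symmetric])
  finally show ?thesis .
qed

section \<open>The gadget\<close>

text \<open>
  The double count of the red edges between \<open>Y\<close> and \<open>T\<close>, where \<open>R\<close> is the relation of red arcs and
  \<open>h\<close> the hub. The matching inside \<open>Y\<close> enters only through the bound \<open>r - k\<close> on its number of arcs.
\<close>

lemma gadget_not_monochromatic:
  fixes R :: "'a rel" and t r k :: nat
  assumes "sym R" "irrefl R"
    and fin: "finite Y" "finite T" and card_T: "card Y = Suc (card T)" and card_Y: "r = card Y"
    and disj: "Y \<inter> T = {}" "h \<notin> Y" "h \<notin> T"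
    and T_nb: "\<And>x. x \<in> T \<Longrightarrow> R `` {x} \<subseteq> Y"
    and Y_nb: "\<And>y. y \<in> Y \<Longrightarrow> R `` {y} \<subseteq> insert h (Y \<union> T)"
    and deg: "\<And>v. v \<in> Y \<union> T \<Longrightarrow> int (card (R `` {v})) \<in> {int t, int r - int t}"
    and inner: "card (R \<inter> Y \<times> Y) \<le> r - k"
    and "odd t" "odd r" "odd k" "t < k" "k \<le> r" "3 * t < r"
  shows "card (R `` {h} \<inter> Y) \<notin> {0, k}"
proof -
  define m where "m = card (R \<inter> Y \<times> Y)"
  define n where "n = card (R `` {h} \<inter> Y)"
  have "even m"
    unfolding m_def
  proof (rule even_card_sym_irrefl)
    show "finite (R \<inter> Y \<times> Y)" using fin by simp
  qed (use \<open>sym R\<close> \<open>irrefl R\<close> in \<open>auto simp: sym_def irrefl_def\<close>)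
  have "(\<Sum>y\<in>Y. card (R `` {y}))
      = (\<Sum>y\<in>Y. card (R `` {y} \<inter> T) + card (R `` {y} \<inter> Y) + card (R `` {y} \<inter> {h}))"
  proof (rule sum.cong)
    fix y assume "y \<in> Y"
    then have "R `` {y} = (R `` {y} \<inter> T) \<union> (R `` {y} \<inter> Y) \<union> (R `` {y} \<inter> {h})"
      using Y_nb[of y] by blast
    moreover have "card \<dots> = card (R `` {y} \<inter> T) + card (R `` {y} \<inter> Y) + card (R `` {y} \<inter> {h})"
      using fin disj by (subst card_Un_disjoint; (subst card_Un_disjoint)?; auto)
    ultimately show "card (R `` {y})
        = card (R `` {y} \<inter> T) + card (R `` {y} \<inter> Y) + card (R `` {y} \<inter> {h})"
      by simp
  qed simp
  also have "\<dots> = card (R \<inter> Y \<times> T) + m + card (R \<inter> Y \<times> {h})"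
    using fin by (simp add: sum.distrib card_Int_Times m_def)
  also have "card (R \<inter> Y \<times> {h}) = n"
    using fin by (subst card_Int_Times_sym[OF \<open>sym R\<close>]) (simp add: card_Int_Times n_def)
  also have "card (R \<inter> Y \<times> T) = (\<Sum>x\<in>T. card (R `` {x}))"
    using fin T_nb by (subst card_Int_Times_sym[OF \<open>sym R\<close>])
      (auto simp: card_Int_Times intro!: sum.cong arg_cong[where f = card])
  finally have "(\<Sum>y\<in>Y. int (card (R `` {y}))) = (\<Sum>x\<in>T. int (card (R `` {x}))) + int m + int n"
    by (metis of_nat_add of_nat_sum)
  moreover define \<beta> b where
    "\<beta> = int (card {y \<in> Y. int (card (R `` {y})) \<noteq> int t})" and
    "b = int (card {x \<in> T. int (card (R `` {x})) \<noteq> int t})"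
  moreover have "(\<Sum>y\<in>Y. int (card (R `` {y}))) = int t * int (card Y) + (int r - 2 * int t) * \<beta>"
    unfolding \<beta>_def using fin deg by (intro sum_two_valued) auto
  moreover have "(\<Sum>x\<in>T. int (card (R `` {x}))) = int t * int (card T) + (int r - 2 * int t) * b"
    unfolding b_def using fin deg by (intro sum_two_valued) auto
  ultimately have "int t * int (card Y) + (int r - 2 * int t) * \<beta>
      = int t * int (card T) + (int r - 2 * int t) * b + int m + int n"
    by simp
  then have balance: "int m + int n = int t + (int r - 2 * int t) * (\<beta> - b)"
    using card_T by (simp add: algebra_simps)
  (* The parity of s is forced by that of m. It rules out the one value of s for which m could lie
     between 0 and r - k: this is s = 0 if n = 0, and s = 1 if n = k. *)
  define s where "s = \<beta> - b"
  define q where "q = int r - 2 * int t"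
  have q: "odd q" "q > int t"
    using \<open>odd r\<close> \<open>3 * t < r\<close> by (auto simp: q_def)
  have m: "0 \<le> int m" "int m \<le> int r - int k"
    using inner \<open>k \<le> r\<close> by (auto simp: m_def)
  have eq: "int m + int n = int t + q * s"
    using balance by (simp add: s_def q_def)
  have "n \<noteq> 0"
  proof
    assume "n = 0"
    with eq have eq0: "int m = int t + q * s" by simp
    have "even (int t + q * s)"
      using \<open>even m\<close> by (metis eq0 even_of_nat)
    then have "odd s" using \<open>odd t\<close> by auto
    then have "s \<le> -1 \<or> s \<ge> 1" by presburger
    then show False
    proof
      assume "s \<le> -1"
      then have "q * s \<le> q * -1" using q by (intro mult_left_mono) auto
      with eq0 q show False by simp
    next
      assume "s \<ge> 1"
      then have "q * s \<ge> q * 1" using q by (intro mult_left_mono) auto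
      with eq0 m \<open>t < k\<close> show False by (simp add: q_def)
    qed
  qed
  moreover have "n \<noteq> k"
  proof
    assume "n = k"
    with eq have eqk: "int m = int t - int k + q * s" by simp
    have "even (int t - int k + q * s)"
      using \<open>even m\<close> by (metis eqk even_of_nat)
    then have "even s" using \<open>odd t\<close> \<open>odd k\<close> q by auto
    then have "s \<le> 0 \<or> s \<ge> 2" by presburger
    then show False
    proof
      assume "s \<le> 0"
      then have "q * s \<le> 0" using q by (simp add: mult_nonneg_nonpos)
      with eqk \<open>t < k\<close> show False by simp
    next
      assume "s \<ge> 2"
      then have "q * s \<ge> q * 2" using q by (intro mult_left_mono) auto
      with eqk m \<open>3 * t < r\<close> show False by (simp add: q_def)
    qed
  qed
  ultimately show ?thesis by (simp add: n_def)
qed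

section \<open>Gadgets around a hub\<close>

datatype vertex = Hub | Near nat nat | Far nat nat

text \<open>
  The matching pairs each odd index with its successor. As \<open>k\<close> and \<open>r\<close> are odd, the interval
  \<open>{k..<r}\<close> is a union of such pairs, whatever \<open>k\<close> is.
\<close>

definition mate :: "nat \<Rightarrow> nat" where
  "mate j = (if odd j then j + 1 else j - 1)"

text \<open>
  Here \<open>q\<close> is the number of gadgets, and gadget \<open>i\<close> is joined to the hub by \<open>k i\<close> edges. Its side \<open>Y\<close>
  consists of the vertices \<open>Near i j\<close>, its side \<open>T\<close> of the vertices \<open>Far i j\<close>.
\<close>

locale gadget_graph =
  fixes r q :: nat and k :: "nat \<Rightarrow> nat"
  assumes odd_r: "odd r"
    and odd_k: "i < q \<Longrightarrow> odd (k i)"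
    and sum_k: "(\<Sum>i<q. k i) = r"
begin

definition V :: "vertex set" where
  "V = insert Hub ((\<Union>i<q. Near i ` {..<r}) \<union> (\<Union>i<q. Far i ` {..<r - 1}))"

fun nb :: "vertex \<Rightarrow> vertex set" where
  "nb Hub = (\<Union>i<q. Near i ` {..<k i})"
| "nb (Near i j) = insert (if j < k i then Hub else Near i (mate j)) (Far i ` {..<r - 1})"
| "nb (Far i j) = Near i ` {..<r}"

definition E :: "vertex rel" where
  "E = (SIGMA u:V. nb u)"

lemma V_iff:
  "v \<in> V \<longleftrightarrow> (case v of Hub \<Rightarrow> True | Near i j \<Rightarrow> i < q \<and> j < r | Far i j \<Rightarrow> i < q \<and> j < r - 1)"
  by (cases v) (auto simp: V_def)

lemma Near_in_nb_Hub: "Near i j \<in> nb Hub \<longleftrightarrow> i < q \<and> j < k i"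
  by auto

lemma k_le: "i < q \<Longrightarrow> k i \<le> r"
  unfolding sum_k[symmetric] by (rule member_le_sum) auto

lemma mate_props:
  assumes "i < q" "k i \<le> j" "j < r"
  shows "k i \<le> mate j" "mate j < r" "mate (mate j) = j" "mate j \<noteq> j"
proof -
  have "odd (k i)" using odd_k assms by simp
  then show "k i \<le> mate j" "mate j < r" "mate (mate j) = j" "mate j \<noteq> j"
    using assms(2,3) odd_r unfolding mate_def by presburger+
qed

lemma finite_V: "finite V"
  by (auto simp: V_def)

lemma E_subset: "E \<subseteq> V \<times> V"
proof clarify
  fix u v assume "(u, v) \<in> E"
  then have "u \<in> V" "v \<in> nb u" by (auto simp: E_def)
  moreover have "v \<in> V"
  proof (cases u)
    case Hub
    with \<open>v \<in> nb u\<close> show ?thesis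
      by (auto simp: V_iff intro: less_le_trans[OF _ k_le])
  next
    case (Near i j)
    with \<open>u \<in> V\<close> \<open>v \<in> nb u\<close> show ?thesis
      using mate_props(2)[of i j] by (auto simp: V_iff split: if_splits)
  next
    case (Far i j)
    with \<open>u \<in> V\<close> \<open>v \<in> nb u\<close> show ?thesis
      by (auto simp: V_iff)
  qed
  ultimately show "u \<in> V \<and> v \<in> V" by simp
qed

lemma sym_E: "sym E"
proof (rule symI)
  fix u v assume "(u, v) \<in> E"
  then have "u \<in> V" "v \<in> V" "v \<in> nb u"
    using E_subset by (auto simp: E_def)
  moreover have "u \<in> nb v"
  proof (cases u)
    case Hub
    with \<open>v \<in> nb u\<close> show ?thesis by auto
  next
    case (Near i j)
    with \<open>u \<in> V\<close> \<open>v \<in> nb u\<close> show ?thesis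
      using mate_props[of i j]
      by (auto simp: V_iff Near_in_nb_Hub simp del: nb.simps(1) split: if_splits)
  next
    case (Far i j)
    with \<open>u \<in> V\<close> \<open>v \<in> nb u\<close> show ?thesis
      by (auto simp: V_iff)
  qed
  ultimately show "(v, u) \<in> E" by (simp add: E_def)
qed

lemma irrefl_E: "irrefl E"
proof -
  have "v \<notin> nb v" if "v \<in> V" for v
  proof (cases v)
    case (Near i j)
    with that show ?thesis
      using mate_props(4)[of i j] by (auto simp: V_iff)
  qed auto
  then show ?thesis by (auto simp: E_def irrefl_def)
qed

lemma card_E:
  assumes "v \<in> V"
  shows "card (E `` {v}) = r"
proof -
  have "card (nb v) = r"
  proof (cases v)
    case Hub
    have "card (\<Union>i<q. Near i ` {..<k i}) = (\<Sum>i<q. card (Near i ` {..<k i}))"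
      by (rule card_UN_disjoint) auto
    also have "\<dots> = r"
      unfolding sum_k[symmetric] by (intro sum.cong) (auto simp: card_image inj_on_def)
    finally show ?thesis using Hub by simp
  next
    case (Near i j)
    then show ?thesis
      using odd_r by (auto simp: card_insert_if card_image inj_on_def dest: odd_pos)
  next
    case (Far i j)
    then show ?thesis by (simp add: card_image inj_on_def)
  qed
  moreover have "E `` {v} = nb v"
    using assms by (auto simp: E_def)
  ultimately show ?thesis by simp
qed

text \<open>
  Each gadget with \<open>k i > t\<close> gives the hub at least one red and at least one blue edge. More than
  \<open>t\<close> of them thus leave the hub with a red degree strictly between \<open>t\<close> and \<open>r - t\<close>.
\<close>

lemma no_factor:
  assumes "R \<subseteq> E" "sym R"
    and deg: "\<forall>v\<in>V. int (card (R `` {v})) \<in> {int t, int r - int t}"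
    and "odd t" "3 * t < r" and many: "t < card {i. i < q \<and> t < k i}"
  shows False
proof -
  define I where "I = {i. i < q \<and> t < k i}"
  define n where "n i = card (R `` {Hub} \<inter> Near i ` {..<r})" for i
  have nbR: "R `` {v} \<subseteq> nb v" for v
    using \<open>R \<subseteq> E\<close> by (auto simp: E_def)
  have "irrefl R"
    using irrefl_E \<open>R \<subseteq> E\<close> by (auto simp: irrefl_def)
  have n_le: "n i \<le> k i" if "i < q" for i
  proof -
    have "R `` {Hub} \<inter> Near i ` {..<r} \<subseteq> Near i ` {..<k i}"
      using nbR[of Hub] by auto
    then have "n i \<le> card (Near i ` {..<k i})"
      unfolding n_def by (intro card_mono) auto
    then show ?thesis
      by (simp add: card_image inj_on_def)
  qed
  have n_I: "n i \<notin> {0, k i}" if "i \<in> I" for i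
    unfolding n_def
  proof (rule gadget_not_monochromatic[where T = "Far i ` {..<r - 1}" and t = t])
    have i: "i < q" "t < k i" using that by (auto simp: I_def)
    show "sym R" "irrefl R" "odd t" "odd r" "odd (k i)" "t < k i" "k i \<le> r" "3 * t < r"
      using i odd_k k_le odd_r \<open>irrefl R\<close> \<open>3 * t < r\<close> \<open>sym R\<close> \<open>odd t\<close> by auto
    show "card (Near i ` {..<r}) = Suc (card (Far i ` {..<r - 1}))" "r = card (Near i ` {..<r})"
      using odd_r by (auto simp: card_image inj_on_def dest: odd_pos)
    show "R `` {x} \<subseteq> Near i ` {..<r}" if "x \<in> Far i ` {..<r - 1}" for x
      using nbR[of x] that by auto
    show "R `` {y} \<subseteq> insert Hub (Near i ` {..<r} \<union> Far i ` {..<r - 1})"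
      if "y \<in> Near i ` {..<r}" for y
    proof -
      from that obtain j where j: "y = Near i j" "j < r" by auto
      have "nb y \<subseteq> insert Hub (Near i ` {..<r} \<union> Far i ` {..<r - 1})"
        using j mate_props(2)[OF i(1) _ j(2)] by (auto split: if_splits)
      with nbR[of y] show ?thesis by (rule subset_trans)
    qed
    show "int (card (R `` {v})) \<in> {int t, int r - int t}"
      if "v \<in> Near i ` {..<r} \<union> Far i ` {..<r - 1}" for v
    proof -
      have "v \<in> V" using that i by (auto simp: V_iff)
      with deg show ?thesis by (rule bspec)
    qed
    have "card (R \<inter> Near i ` {..<r} \<times> Near i ` {..<r})
        = (\<Sum>j<r. card (R `` {Near i j} \<inter> Near i ` {..<r}))"
      by (simp add: card_Int_Times sum.reindex inj_on_def)
    also have "\<dots> \<le> (\<Sum>j<r. if j < k i then 0 else 1)"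
    proof (rule sum_mono)
      fix j
      have "R `` {Near i j} \<inter> Near i ` {..<r} \<subseteq> (if j < k i then {} else {Near i (mate j)})"
        using nbR[of "Near i j"] by (auto split: if_splits)
      then have "card (R `` {Near i j} \<inter> Near i ` {..<r})
          \<le> card (if j < k i then {} else {Near i (mate j)})"
        by (intro card_mono) auto
      then show "card (R `` {Near i j} \<inter> Near i ` {..<r}) \<le> (if j < k i then 0 else 1)"
        by (simp split: if_splits)
    qed
    also have "\<dots> = card ({..<r} - {..<k i})"
      by (simp add: sum.If_cases Diff_eq lessThan_def Collect_neg_eq)
    also have "\<dots> = r - k i"
      by (subst card_Diff_subset) (use i k_le in auto)
    finally show "card (R \<inter> Near i ` {..<r} \<times> Near i ` {..<r}) \<le> r - k i" .
  qed auto
  have "R `` {Hub} = (\<Union>i<q. R `` {Hub} \<inter> Near i ` {..<r})"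
  proof (intro equalityI subsetI)
    fix v assume v: "v \<in> R `` {Hub}"
    then obtain i j where "i < q" "j < k i" "v = Near i j"
      using nbR[of Hub] by auto
    then have "v \<in> Near i ` {..<r}"
      using k_le[of i] by simp
    with v \<open>i < q\<close> show "v \<in> (\<Union>i<q. R `` {Hub} \<inter> Near i ` {..<r})"
      by auto
  qed auto
  also have "card \<dots> = (\<Sum>i<q. n i)"
    unfolding n_def by (rule card_UN_disjoint) auto
  finally have hub: "card (R `` {Hub}) = (\<Sum>i<q. n i)" .
  have card_I: "card I = (\<Sum>i<q. if i \<in> I then 1 else 0)"
    by (simp add: sum.If_cases I_def Int_def)
  have "card I \<le> (\<Sum>i<q. n i)"
    unfolding card_I using n_I by (intro sum_mono) (auto simp: Suc_le_eq)
  moreover have "(\<Sum>i<q. n i) + card I \<le> r"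
    unfolding card_I sum_k[symmetric] sum.distrib[symmetric]
    using n_I n_le by (intro sum_mono) (force simp: Suc_le_eq le_neq_implies_less)
  ultimately have "int (card (R `` {Hub})) > int t" "int (card (R `` {Hub})) < int r - int t"
    using many unfolding hub I_def by linarith+
  moreover have "int (card (R `` {Hub})) \<in> {int t, int r - int t}"
    using deg by (rule bspec) (simp add: V_iff)
  ultimately show False by auto
qed

end

theorem theorem5:
  fixes t r :: nat
  assumes "odd t" and "r > 0"
    and "even r \<or> r \<ge> (t + 1) * (t + 2)"
  shows "\<exists>G :: nat pair_pre_digraph.
           regular_graph r G \<and> \<not> (\<exists>F. is_factor {int t, int r - int t} G F)"
proof (cases "even r")
  case True
  define E where "E = {(u, v). u \<le> r \<and> v \<le> r \<and> u \<noteq> v}"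
  show ?thesis
  proof (rule regular_graph_without_factor)
    show "finite {..r}" "{..r} \<noteq> {}" "E \<subseteq> {..r} \<times> {..r}" "sym E" "irrefl E"
      by (auto simp: E_def sym_def irrefl_def)
    show "card (E `` {v}) = r" if "v \<in> {..r}" for v
    proof -
      have "E `` {v} = {..r} - {v}"
        using that by (auto simp: E_def)
      then show ?thesis using that by simp
    qed
  next
    fix R assume R: "R \<subseteq> E" "sym R" "\<forall>v\<in>{..r}. int (card (R `` {v})) \<in> {int t, int r - int t}"
    have "R = R \<inter> {..r} \<times> {..r}"
      using R(1) by (auto simp: E_def)
    then have "card R = card (R \<inter> {..r} \<times> {..r})" by simp
    also have "\<dots> = (\<Sum>v\<le>r. card (R `` {v}))"
      using R(1) by (auto simp: card_Int_Times E_def intro!: sum.cong arg_cong[where f = card])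
    also have "odd \<dots>"
    proof -
      have "odd (card (R `` {v}))" if "v \<le> r" for v
      proof -
        have "int (card (R `` {v})) \<in> {int t, int r - int t}" using R(3) that by simp
        moreover have "odd (int t)" "odd (int r - int t)"
          using \<open>odd t\<close> \<open>even r\<close> by simp_all
        ultimately have "odd (int (card (R `` {v})))" by (metis insertE singletonD)
        then show ?thesis by simp
      qed
      then have "{v \<in> {..r}. odd (card (R `` {v}))} = {..r}" by auto
      then show ?thesis using \<open>even r\<close> by (simp add: even_sum_iff)
    qed
    finally have "odd (card R)" .
    moreover have "even (card R)"
    proof (rule even_card_sym_irrefl)
      show "finite R"
        by (rule finite_subset[of _ "{..r} \<times> {..r}"]) (use R(1) in \<open>auto simp: E_def\<close>)
    qed (use R in \<open>auto simp: E_def irrefl_def\<close>)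
    ultimately show False by simp
  qed
next
  case False
  then have "odd r" and r: "r \<ge> (t + 1) * (t + 2)" using assms by auto
  define k where "k i = (if i < t + 1 then t + 2 else r - (t + 1) * (t + 2))" for i
  interpret gadget_graph r "t + 2" k
  proof
    show "odd r" by fact
    show "odd (k i)" if "i < t + 2" for i
      using \<open>odd t\<close> \<open>odd r\<close> r by (simp add: k_def)
    show "(\<Sum>i<t + 2. k i) = r"
      using r by (simp add: k_def)
  qed
  show ?thesis
  proof (rule regular_graph_without_factor[OF finite_V _ E_subset sym_E irrefl_E card_E])
    show "V \<noteq> {}" using V_def by blast
  next
    fix R assume R: "R \<subseteq> E" "sym R" "\<forall>v\<in>V. int (card (R `` {v})) \<in> {int t, int r - int t}"
    have "card {..<t + 1} \<le> card {i. i < t + 2 \<and> t < k i}"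
      by (intro card_mono) (auto simp: k_def)
    moreover have "3 * t < r"
      using r by simp
    ultimately show False
      using no_factor[OF R \<open>odd t\<close>] by simp
  qed
qed

end
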